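(* Let $1<p<q<\infty$ and $1<r<\infty$, and let $p',q',r'$ be the conjugate exponents. Then $$(\ell^p_{q,r}(\mathbb Z))^*\cong\mathrm h^{p'}_{q',r'}(\mathbb Z)$$ isometrically, via the canonical pairing $\langle x,y\rangle=\sum_{n\in\mathbb Z}x(n)y(n)$. More precisely, for $f\in(\ell^p_{q,r}(\mathbb Z))^*$ the sequence $y$ defined by $y(n):=f(e_n)$ belongs to $\mathrm h^{p'}_{q',r'}(\mathbb Z)$ and represents $f$ by $$f(x)=\sum_{n\in\mathbb Z}x(n)y(n)\qquad(x\in\ell^p_{q,r}(\mathbb Z)).$$ Conversely, every $y\in\mathrm h^{p'}_{q',r'}(\mathbb Z)$ defines a bounded functional on $\ell^p_{q,r}(\mathbb Z)$ by the same formula.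
   Context: For $j\in\mathbb N_0=\{0,1,2,\dots\}$ and $k\in\mathbb Z$ let $I(j,k)=[2^jk,2^j(k+1))\cap\mathbb Z$, with $|I(j,k)|=2^j$ elements; these are the dyadic intervals. All sequences are real. $e_n$ is the canonical unit sequence: $e_n(n)=1$ and $e_n(k)=0$ for $k\ne n$. For a sequence $x\in\mathbb R^{\mathbb Z}$ put $$\|x\|_{\ell^p_{q,r}}=\Big(\sum_{j=0}^\infty\sum_{k\in\mathbb Z}(2^j)^{r(\frac1q-\frac1p)}\Big(\sum_{l\in I(j,k)}|x(l)|^p\Big)^{r/p}\Big)^{1/r},$$ and let $\ell^p_{q,r}(\mathbb Z)$ be the space of all $x$ with $\|x\|_{\ell^p_{q,r}}<\infty$. A $(q',p')$-block with respect to a dyadic interval $I$ is a sequence $a\in\mathbb R^{\mathbb Z}$ with $\operatorname{supp}a\subset I$ and $\|a\|_{\ell^{p'}}\le|I|^{\frac1{p'}-\frac1{q'}}$. The block space $\mathrm h^{p'}_{q',r'}(\mathbb Z)$ is the set of all $y\in\mathbb R^{\mathbb Z}$ that can be written as $$y=\sum_{(j,k)\in\mathbb N_0\times\mathbb Z}\lambda^j_k a^j_k,$$ with $\lambda=(\lambda^j_k)\in\ell^{r'}(\mathbb N_0\times\mathbb Z)$ and each $a^j_k$ a $(q',p')$-block with respect to $I(j,k)$, the series converging in $\ell^1_{\mathrm{loc}}$ (i.e. in $\ell^1$ on every finite subset of $\mathbb Z$). Its norm is $\|y\|_{\mathrm h^{p'}_{q',r'}}=\inf\|\lambda\|_{\ell^{r'}}$,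 the infimum being over all such representations. *)

theory Defs
  imports "HOL-Analysis.Analysis"
begin

definition dyadic :: "nat \<times> int \<Rightarrow> int set" where
  "dyadic = (\<lambda>(j, k). {2 ^ j * k ..< 2 ^ j * (k + 1)})"

definition unit_seq :: "int \<Rightarrow> int \<Rightarrow> real" where
  "unit_seq n = (\<lambda>k. if k = n then 1 else 0)"

text \<open>
  The norms below are real-valued and are only meaningful on the corresponding space, since
  \<^const>\<open>infsum\<close> is 0 on families that are not summable; finiteness of a norm is expressed by
  summability of the underlying nonnegative family.
\<close>

definition lp_space :: "real \<Rightarrow> ('i \<Rightarrow> real) set" where
  "lp_space s = {x. (\<lambda>i. \<bar>x i\<bar> powr s) summable_on UNIV}"

definition lp_norm :: "real \<Rightarrow> ('i \<Rightarrow> real) \<Rightarrow> real" where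
  "lp_norm s x = (\<Sum>\<^sub>\<infinity>i. \<bar>x i\<bar> powr s) powr (1 / s)"

definition lpqr_term :: "real \<Rightarrow> real \<Rightarrow> real \<Rightarrow> (int \<Rightarrow> real) \<Rightarrow> nat \<times> int \<Rightarrow> real" where
  "lpqr_term p q r x = (\<lambda>(j, k). (2 ^ j) powr (r * (1 / q - 1 / p)) *
     (\<Sum>l\<in>dyadic (j, k). \<bar>x l\<bar> powr p) powr (r / p))"

definition lpqr_space :: "real \<Rightarrow> real \<Rightarrow> real \<Rightarrow> (int \<Rightarrow> real) set" where
  "lpqr_space p q r = {x. lpqr_term p q r x summable_on UNIV}"

definition lpqr_norm :: "real \<Rightarrow> real \<Rightarrow> real \<Rightarrow> (int \<Rightarrow> real) \<Rightarrow> real" where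
  "lpqr_norm p q r x = (\<Sum>\<^sub>\<infinity>jk. lpqr_term p q r x jk) powr (1 / r)"

definition is_block :: "real \<Rightarrow> real \<Rightarrow> int set \<Rightarrow> (int \<Rightarrow> real) \<Rightarrow> bool" where
  "is_block q p I a \<longleftrightarrow>
     {n. a n \<noteq> 0} \<subseteq> I \<and> a \<in> lp_space p \<and> lp_norm p a \<le> real (card I) powr (1 / p - 1 / q)"

text \<open>
  Convergence of an unordered series of sequences in \<open>\<ell>\<^sup>1\<close> on every finite set of integers:
  the limit is taken along the net of finite partial sums.
\<close>

definition has_sum_l1_loc :: "('i \<Rightarrow> int \<Rightarrow> real) \<Rightarrow> (int \<Rightarrow> real) \<Rightarrow> bool" where
  "has_sum_l1_loc u y \<longleftrightarrow> (\<forall>F. finite F \<longrightarrow>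
     ((\<lambda>S. \<Sum>n\<in>F. \<bar>(\<Sum>i\<in>S. u i n) - y n\<bar>) \<longlongrightarrow> 0) (finite_subsets_at_top UNIV))"

definition block_rep ::
  "real \<Rightarrow> real \<Rightarrow> real \<Rightarrow> (int \<Rightarrow> real) \<Rightarrow> (nat \<times> int \<Rightarrow> real) \<Rightarrow> (nat \<times> int \<Rightarrow> int \<Rightarrow> real) \<Rightarrow> bool"
where
  "block_rep p q r y c a \<longleftrightarrow>
     c \<in> lp_space r \<and> (\<forall>jk. is_block q p (dyadic jk) (a jk)) \<and>
     has_sum_l1_loc (\<lambda>jk n. c jk * a jk n) y"

definition block_space :: "real \<Rightarrow> real \<Rightarrow> real \<Rightarrow> (int \<Rightarrow> real) set" where
  "block_space p q r = {y. \<exists>c a. block_rep p q r y c a}"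

definition block_norm :: "real \<Rightarrow> real \<Rightarrow> real \<Rightarrow> (int \<Rightarrow> real) \<Rightarrow> real" where
  "block_norm p q r y = Inf {lp_norm r c | c. \<exists>a. block_rep p q r y c a}"

text \<open>
  Normed spaces of real functions are represented by a carrier set together with a norm that is
  only relevant on that carrier; vector space operations are pointwise.
\<close>

definition lin_subspace :: "('a \<Rightarrow> real) set \<Rightarrow> bool" where
  "lin_subspace V \<longleftrightarrow> (\<lambda>_. 0) \<in> V \<and>
     (\<forall>x\<in>V. \<forall>y\<in>V. (\<lambda>t. x t + y t) \<in> V) \<and> (\<forall>c. \<forall>x\<in>V. (\<lambda>t. c * x t) \<in> V)"

definition bounded_functional_on ::
  "('a \<Rightarrow> real) set \<Rightarrow> (('a \<Rightarrow> real) \<Rightarrow> real) \<Rightarrow> (('a \<Rightarrow> real) \<Rightarrow> real) \<Rightarrow> bool" where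
  "bounded_functional_on V N f \<longleftrightarrow>
     (\<forall>x\<in>V. \<forall>y\<in>V. f (\<lambda>t. x t + y t) = f x + f y) \<and>
     (\<forall>c. \<forall>x\<in>V. f (\<lambda>t. c * x t) = c * f x) \<and>
     (\<exists>C. \<forall>x\<in>V. \<bar>f x\<bar> \<le> C * N x)"

text \<open>
  Elements of the dual are represented by functions on the ambient type; their value off \<open>V\<close> is
  fixed to be 0 so that each functional on \<open>V\<close> has exactly one representative.
\<close>

definition dual_space ::
  "('a \<Rightarrow> real) set \<Rightarrow> (('a \<Rightarrow> real) \<Rightarrow> real) \<Rightarrow> (('a \<Rightarrow> real) \<Rightarrow> real) set" where
  "dual_space V N = {f. bounded_functional_on V N f \<and> (\<forall>x. x \<notin> V \<longrightarrow> f x = 0)}"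

definition dual_norm ::
  "('a \<Rightarrow> real) set \<Rightarrow> (('a \<Rightarrow> real) \<Rightarrow> real) \<Rightarrow> (('a \<Rightarrow> real) \<Rightarrow> real) \<Rightarrow> real" where
  "dual_norm V N f = Sup {\<bar>f x\<bar> | x. x \<in> V \<and> N x \<le> 1}"

definition isometric_isomorphism ::
  "('a \<Rightarrow> real) set \<Rightarrow> (('a \<Rightarrow> real) \<Rightarrow> real) \<Rightarrow> ('b \<Rightarrow> real) set \<Rightarrow> (('b \<Rightarrow> real) \<Rightarrow> real) \<Rightarrow>
   (('a \<Rightarrow> real) \<Rightarrow> 'b \<Rightarrow> real) \<Rightarrow> bool" where
  "isometric_isomorphism V N W M T \<longleftrightarrow>
     lin_subspace V \<and> lin_subspace W \<and> bij_betw T V W \<and>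
     (\<forall>x\<in>V. \<forall>y\<in>V. T (\<lambda>t. x t + y t) = (\<lambda>s. T x s + T y s)) \<and>
     (\<forall>c. \<forall>x\<in>V. T (\<lambda>t. c * x t) = (\<lambda>s. c * T x s)) \<and>
     (\<forall>x\<in>V. M (T x) = N x)"

definition pairing :: "(int \<Rightarrow> real) \<Rightarrow> (int \<Rightarrow> real) \<Rightarrow> real" where
  "pairing x y = (\<Sum>\<^sub>\<infinity>n. x n * y n)"

end

theory Submission
  imports Defs
begin

text \<open>
  Let \<open>w (j, k)\<close> be \<open>2\<^sup>j\<close> raised to the negative power \<open>1/q - 1/p\<close>. The map
  \<open>x \<mapsto> (w jk x | I jk)\<close>, with \<open>jk\<close> running over all dyadic intervals, embeds
  \<open>\<ell>\<^sup>p\<^sub>q\<^sub>,\<^sub>r\<close> isometrically into \<open>\<ell>\<^sup>r(\<ell>\<^sup>p)\<close>, whose dual is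
  \<open>\<ell>\<^bsup>r'\<^esup>(\<ell>\<^bsup>p'\<^esup>)\<close>. A block expansion \<open>y = \<Sum> \<lambda> jk a jk\<close> with \<open>\<parallel>\<lambda>\<parallel> \<le> C\<close> is the same thing as
  a family \<open>b jk = \<lambda> jk a jk\<close> of sequences, \<open>b jk\<close> living on \<open>I jk\<close>, such that the numbers
  \<open>\<parallel>b jk\<parallel> / w jk\<close> have \<open>\<ell>\<^bsup>r'\<^esup>\<close> norm at most \<open>C\<close>; these families form the
  set \<open>families C\<close>, and \<open>y\<close> is their \<open>family_sum\<close>.

  Two applications of Holder's inequality, one inside the intervals and one across them, show that
  the sum of a family in \<open>families C\<close> pairs with \<open>\<ell>\<^sup>p\<^sub>q\<^sub>,\<^sub>r\<close> absolutely, with bound \<open>C\<close>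
  (\<open>family_pairing\<close>). This gives one half of the theorem.

  For the other half one has to write the coefficients \<open>y n = f (e n)\<close> of a functional of norm \<open>C\<close>
  as the sum of a family in \<open>families C\<close>. The usual argument extends \<open>f\<close> to \<open>\<ell>\<^sup>r(\<ell>\<^sup>p)\<close> by the
  Hahn--Banach theorem. Here the extension is replaced by compactness and a nearest point.
  The set \<open>families C\<close> is convex, and it is compact for pointwise convergence (Tychonoff). Summing a
  family is continuous on it, because the entries at level \<open>j\<close> are at most \<open>C w j\<close> and these bounds
  form a geometric series. Hence it is enough to
  match \<open>y\<close> on each finite set \<open>F\<close> of integers (\<open>representation\<close>). Among the families
  in \<open>families C\<close> take one whose sum is nearest to \<open>y\<close> in the Euclidean norm on \<open>F\<close>, and let \<open>x\<close> be
  the difference between \<open>y\<close> and that sum. Minimality says that the sum maximises the pairing with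
  \<open>x\<close>. The supremum of this pairing is \<open>C \<parallel>x\<parallel>\<close>, as equality in Holder's inequality is attained
  (\<open>norming_family\<close>), whereas the pairing of \<open>y\<close> with \<open>x\<close> is \<open>f x \<le> C \<parallel>x\<parallel>\<close>. But the latter
  pairing exceeds the former by the squared Euclidean length of \<open>x\<close>, so \<open>x = 0\<close> (\<open>finite_representation\<close>).

  Finitely supported sequences are dense because \<open>r\<close> is finite (\<open>truncation_tail_small\<close>), so
  the coefficients determine the functional. The constants in both halves agree, which makes the
  correspondence isometric. That the block space is closed under addition is read off from the dual.
\<close>

section \<open>Finite \<open>\<ell>\<^sup>s\<close> norms\<close>

text \<open>
  Norms over a finite index set. The index type is arbitrary because the same inequalities are needed
  inside a dyadic interval (exponents \<open>p\<close>, \<open>p'\<close>) and across the intervals (exponents \<open>r\<close>, \<open>r'\<close>).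
\<close>

definition lnorm :: "real \<Rightarrow> 'i set \<Rightarrow> ('i \<Rightarrow> real) \<Rightarrow> real" where
  "lnorm s I v = (\<Sum>i\<in>I. \<bar>v i\<bar> powr s) powr (1 / s)"

lemma lnorm_nonneg [simp]: "0 \<le> lnorm s I v"
  by (simp add: lnorm_def)

lemma lnorm_powr: "0 < s \<Longrightarrow> lnorm s I v powr s = (\<Sum>i\<in>I. \<bar>v i\<bar> powr s)"
  by (simp add: lnorm_def powr_powr sum_nonneg)

lemma lnorm_cong: "(\<And>i. i \<in> I \<Longrightarrow> u i = v i) \<Longrightarrow> lnorm s I u = lnorm s I v"
  by (simp add: lnorm_def)

lemma lnorm_mono:
  assumes "0 < s" "\<And>i. i \<in> I \<Longrightarrow> \<bar>u i\<bar> \<le> \<bar>v i\<bar>"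
  shows "lnorm s I u \<le> lnorm s I v"
  unfolding lnorm_def using assms
  by (intro powr_mono2 sum_mono sum_nonneg) auto

lemma lnorm_mono_set:
  assumes "0 < s" "finite J" "I \<subseteq> J"
  shows "lnorm s I v \<le> lnorm s J v"
  unfolding lnorm_def using assms
  by (intro powr_mono2 sum_mono2 sum_nonneg) auto

lemma lnorm_scale:
  assumes "0 < s"
  shows "lnorm s I (\<lambda>i. c * v i) = \<bar>c\<bar> * lnorm s I v"
proof -
  have "(\<Sum>i\<in>I. \<bar>c * v i\<bar> powr s) = \<bar>c\<bar> powr s * (\<Sum>i\<in>I. \<bar>v i\<bar> powr s)"
    by (simp add: abs_mult powr_mult sum_distrib_left)
  then show ?thesis
    using assms by (simp add: lnorm_def powr_mult sum_nonneg powr_powr)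
qed

lemma lnorm_zero [simp]: "lnorm s I (\<lambda>i. 0) = 0"
  by (simp add: lnorm_def)

lemma abs_le_lnorm:
  assumes "0 < s" "finite I" "i \<in> I"
  shows "\<bar>v i\<bar> \<le> lnorm s I v"
proof -
  have "lnorm s {i} v \<le> lnorm s I v"
    using assms by (intro lnorm_mono_set) auto
  then show ?thesis
    using assms by (simp add: lnorm_def powr_powr)
qed

lemma lnorm_pos_imp_nonzero:
  assumes "0 < s" "finite I" "lnorm s I v = 0" "i \<in> I"
  shows "v i = 0"
  using abs_le_lnorm[OF assms(1,2,4), of v] assms(3) by simp

text \<open>
  Both factors are normalised to norm 1; then Young's inequality is summed termwise.
\<close>

lemma Holder_lnorm:
  assumes s: "1 < s" "1 < s'" "1 / s + 1 / s' = 1" and I: "finite I"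
  shows "(\<Sum>i\<in>I. \<bar>u i * v i\<bar>) \<le> lnorm s I u * lnorm s' I v"
proof (cases "lnorm s I u = 0 \<or> lnorm s' I v = 0")
  case True
  then have "\<forall>i\<in>I. u i * v i = 0"
    using lnorm_pos_imp_nonzero[of s I u] lnorm_pos_imp_nonzero[of s' I v] s I by auto
  then have "(\<Sum>i\<in>I. \<bar>u i * v i\<bar>) = 0"
    by (intro sum.neutral) auto
  then show ?thesis
    by (metis lnorm_nonneg mult_nonneg_nonneg)
next
  case False
  define a where "a = lnorm s I u"
  define b where "b = lnorm s' I v"
  have pos: "0 < a" "0 < b"
    using False by (auto simp: a_def b_def less_le)
  have young: "\<bar>u i\<bar> / a * (\<bar>v i\<bar> / b)
      \<le> (\<bar>u i\<bar> powr s / a powr s) / s + (\<bar>v i\<bar> powr s' / b powr s') / s'" for i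
    using Youngs_inequality[of s s' "\<bar>u i\<bar> / a" "\<bar>v i\<bar> / b"] s pos
    by (simp add: powr_divide)
  have "(\<Sum>i\<in>I. \<bar>u i * v i\<bar>) / (a * b) = (\<Sum>i\<in>I. \<bar>u i\<bar> / a * (\<bar>v i\<bar> / b))"
    by (simp add: sum_divide_distrib abs_mult)
  also have "\<dots> \<le> (\<Sum>i\<in>I. (\<bar>u i\<bar> powr s / a powr s) / s + (\<bar>v i\<bar> powr s' / b powr s') / s')"
    by (intro sum_mono young)
  also have "\<dots> = ((\<Sum>i\<in>I. \<bar>u i\<bar> powr s) / a powr s) / s + ((\<Sum>i\<in>I. \<bar>v i\<bar> powr s') / b powr s') / s'"
    by (simp add: sum.distrib sum_divide_distrib)
  also have "\<dots> = 1"
  proof -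
    have "(\<Sum>i\<in>I. \<bar>u i\<bar> powr s) = a powr s" "(\<Sum>i\<in>I. \<bar>v i\<bar> powr s') = b powr s'"
      using s by (simp_all add: a_def b_def lnorm_powr)
    then show ?thesis
      using s pos by simp
  qed
  finally show ?thesis
    using pos by (simp add: a_def b_def)
qed

text \<open>
  Equality in Holder's inequality is attained by \<open>sgn v \<bar>v\<bar>\<close> with the modulus raised to \<open>s - 1\<close>,
  normalised. The exponents fit because \<open>(s - 1) s' = s\<close>.
\<close>

lemma norming_exists:
  assumes s: "1 < s" "1 < s'" "1 / s + 1 / s' = 1"
  obtains z where "lnorm s' I z \<le> 1" "(\<Sum>i\<in>I. v i * z i) = lnorm s I v"
proof (cases "lnorm s I v = 0 \<or> infinite I")
  case True
  then show ?thesis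
    by (intro that[of "\<lambda>_. 0"]) (auto simp: lnorm_def)
next
  case False
  define a where "a = lnorm s I v"
  have a: "0 < a"
    using False by (auto simp: a_def less_le)
  have as: "(\<Sum>i\<in>I. \<bar>v i\<bar> powr s) = a powr s"
    using s by (simp add: a_def lnorm_powr)
  define z where "z = (\<lambda>i. sgn (v i) * (\<bar>v i\<bar> powr (s - 1) / a powr (s - 1)))"
  have conj: "(s - 1) * s' = s"
    using s by (simp add: field_simps)
  have "\<bar>z i\<bar> powr s' = \<bar>v i\<bar> powr s / a powr s" for i
    using s a conj by (cases "v i = 0") (auto simp: z_def abs_mult powr_divide powr_powr)
  then have "(\<Sum>i\<in>I. \<bar>z i\<bar> powr s') = 1"
    using as a by (simp flip: sum_divide_distrib)
  then have 1: "lnorm s' I z \<le> 1"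
    by (simp add: lnorm_def)
  have "v i * z i = \<bar>v i\<bar> powr s / a powr (s - 1)" for i
  proof (cases "v i = 0")
    case False
    then have "\<bar>v i\<bar> powr s = \<bar>v i\<bar> * \<bar>v i\<bar> powr (s - 1)"
      by (simp add: powr_mult_base)
    moreover have "v i * sgn (v i) = \<bar>v i\<bar>"
      by (simp add: abs_sgn)
    ultimately show ?thesis
      by (simp add: z_def flip: mult.assoc)
  qed (use s in auto)
  then have "(\<Sum>i\<in>I. v i * z i) = a powr s / a powr (s - 1)"
    by (simp add: as flip: sum_divide_distrib)
  also have "\<dots> = a"
    using a by (simp flip: powr_diff)
  finally show ?thesis
    using that 1 a_def by blast
qed

text \<open>
  The norm is a maximum of linear functionals, by Holder's inequality and \<open>norming_exists\<close>, hence
  subadditive.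
\<close>

lemma Minkowski_lnorm:
  assumes s: "1 < s" "finite I"
  shows "lnorm s I (\<lambda>i. u i + v i) \<le> lnorm s I u + lnorm s I v"
proof -
  define s' where "s' = s / (s - 1)"
  have s': "1 < s'" "1 / s + 1 / s' = 1"
    using s by (auto simp: s'_def field_simps)
  obtain z where z: "lnorm s' I z \<le> 1" "(\<Sum>i\<in>I. (u i + v i) * z i) = lnorm s I (\<lambda>i. u i + v i)"
    using norming_exists[of s s' I "\<lambda>i. u i + v i"] s s' by blast
  have bound: "(\<Sum>i\<in>I. g i * z i) \<le> lnorm s I g" for g
  proof -
    have "(\<Sum>i\<in>I. g i * z i) \<le> (\<Sum>i\<in>I. \<bar>g i * z i\<bar>)"
      by (intro sum_mono) auto
    also have "\<dots> \<le> lnorm s I g * lnorm s' I z"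
      by (intro Holder_lnorm s s')
    also have "\<dots> \<le> lnorm s I g"
      using z by (intro mult_left_le) auto
    finally show ?thesis .
  qed
  have "lnorm s I (\<lambda>i. u i + v i) = (\<Sum>i\<in>I. u i * z i) + (\<Sum>i\<in>I. v i * z i)"
    using z by (simp add: algebra_simps sum.distrib)
  then show ?thesis
    using bound[of u] bound[of v] by linarith
qed

lemma lp_norm_nonneg [simp]: "0 \<le> lp_norm s c"
  by (simp add: lp_norm_def)

lemma lnorm_le_lp_norm:
  assumes "0 < s" "c \<in> lp_space s" "finite S"
  shows "lnorm s S c \<le> lp_norm s c"
  using assms unfolding lnorm_def lp_norm_def lp_space_def
  by (intro powr_mono2 finite_sum_le_infsum sum_nonneg) auto

text \<open>
  Together with \<open>lnorm_le_lp_norm\<close> this reduces every question about an infinite \<open>\<ell>\<^sup>s\<close> norm to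
  bounds on finite index sets that are uniform.
\<close>

lemma lp_space_lnormI:
  assumes "0 < s" "\<And>S. finite S \<Longrightarrow> lnorm s S c \<le> C"
  shows "c \<in> lp_space s" "lp_norm s c \<le> C"
proof -
  have C: "0 \<le> C"
    using assms(2)[of "{}"] by (simp add: lnorm_def)
  have fin: "(\<Sum>i\<in>S. \<bar>c i\<bar> powr s) \<le> C powr s" if "finite S" for S
    using powr_mono2[of s "lnorm s S c" C] assms that by (simp add: lnorm_powr)
  show c: "c \<in> lp_space s"
    unfolding lp_space_def mem_Collect_eq
    by (rule nonneg_bdd_above_summable_on) (auto simp: bdd_above_def intro!: exI[of _ "C powr s"] fin)
  have "(\<Sum>\<^sub>\<infinity>i. \<bar>c i\<bar> powr s) \<le> C powr s"
    using c by (intro infsum_le_finite_sums fin) (auto simp: lp_space_def)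
  then have "lp_norm s c \<le> (C powr s) powr (1 / s)"
    unfolding lp_norm_def using assms(1) by (intro powr_mono2 infsum_nonneg) auto
  then show "lp_norm s c \<le> C"
    using assms(1) C by (simp add: powr_powr)
qed

lemma lp_norm_finite_support:
  assumes "finite I" "\<And>i. i \<notin> I \<Longrightarrow> a i = 0"
  shows "a \<in> lp_space s" "lp_norm s a = lnorm s I a"
proof -
  have "((\<lambda>i. \<bar>a i\<bar> powr s) has_sum (\<Sum>i\<in>I. \<bar>a i\<bar> powr s)) UNIV"
    using assms by (intro has_sum_finite_neutralI) auto
  then show "a \<in> lp_space s" "lp_norm s a = lnorm s I a"
    by (auto simp: lp_space_def lp_norm_def lnorm_def has_sum_iff)
qed

section \<open>Auxiliary facts on compactness, convexity and duals\<close>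

text \<open>
  Tychonoff's theorem, applied once for each argument.
\<close>

lemma compact_box:
  fixes M :: "'a \<Rightarrow> 'b \<Rightarrow> real"
  shows "compact {b. \<forall>i n. \<bar>b i n\<bar> \<le> M i n}"
proof -
  have inner: "compact (PiE UNIV (\<lambda>n. {- M i n..M i n}))" for i
    using compactin_PiE[of "\<lambda>_. euclidean" UNIV "\<lambda>n. {- M i n..M i n}"]
    by (simp add: euclidean_product_topology)
  have "compact (PiE UNIV (\<lambda>i. PiE UNIV (\<lambda>n. {- M i n..M i n})))"
    using compactin_PiE[of "\<lambda>_. euclidean" UNIV "\<lambda>i. PiE UNIV (\<lambda>n. {- M i n..M i n})"] inner
    by (simp add: euclidean_product_topology)
  also have "PiE UNIV (\<lambda>i. PiE UNIV (\<lambda>n. {- M i n..M i n})) = {b. \<forall>i n. \<bar>b i n\<bar> \<le> M i n}"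
  proof -
    have "\<bar>a\<bar> \<le> m \<longleftrightarrow> a \<in> {- m..m}" for a m :: real
      by auto
    then show ?thesis
      by (simp only: PiE_UNIV_domain) blast
  qed
  finally show ?thesis .
qed

text \<open>
  The first-order condition at the end point of a segment on which a quadratic function is minimal.
\<close>

lemma linear_coefficient_nonneg:
  fixes D E :: real
  assumes "\<And>t. 0 < t \<Longrightarrow> t \<le> 1 \<Longrightarrow> 0 \<le> 2 * t * D + t\<^sup>2 * E"
  shows "0 \<le> D"
proof (rule ccontr)
  assume "\<not> 0 \<le> D"
  \<comment> \<open>Small enough for the quadratic term to be dominated by the linear one.\<close>
  define t where "t = min 1 (- D / (\<bar>E\<bar> + 1))"
  have t: "0 < t" "t \<le> 1"
    using \<open>\<not> 0 \<le> D\<close> by (auto simp: t_def divide_neg_pos)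
  have "t \<le> - D / (\<bar>E\<bar> + 1)"
    by (simp add: t_def)
  then have "t * (\<bar>E\<bar> + 1) \<le> - D"
    by (subst (asm) pos_le_divide_eq) auto
  then have "t * E \<le> - D"
    using t mult_left_mono[of E "\<bar>E\<bar> + 1" t] by linarith
  moreover have "0 \<le> t * (2 * D + t * E)"
    using assms[OF t] by (simp add: algebra_simps power2_eq_square)
  ultimately show False
    using t \<open>\<not> 0 \<le> D\<close> by (simp add: zero_le_mult_iff)
qed

lemma dual_space_bounded: "f \<in> dual_space V M \<Longrightarrow> bounded_functional_on V M f"
  by (simp add: dual_space_def)

lemma lin_subspace_dual_space: "lin_subspace (dual_space V M)"
  unfolding lin_subspace_def
proof (intro conjI ballI allI)
  show "(\<lambda>_. 0) \<in> dual_space V M"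
    by (auto simp: dual_space_def bounded_functional_on_def intro!: exI[of _ 0])
next
  fix f g assume fg: "f \<in> dual_space V M" "g \<in> dual_space V M"
  then obtain C D where CD: "\<forall>x\<in>V. \<bar>f x\<bar> \<le> C * M x" "\<forall>x\<in>V. \<bar>g x\<bar> \<le> D * M x"
    by (auto simp: dual_space_def bounded_functional_on_def)
  have "\<bar>f x + g x\<bar> \<le> (C + D) * M x" if "x \<in> V" for x
    using CD[THEN bspec, OF that] abs_triangle_ineq[of "f x" "g x"]
    unfolding distrib_right by linarith
  then have "\<exists>C. \<forall>x\<in>V. \<bar>f x + g x\<bar> \<le> C * M x"
    by blast
  with fg show "(\<lambda>t. f t + g t) \<in> dual_space V M"
    by (simp add: dual_space_def bounded_functional_on_def distrib_left add_ac)
next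
  fix c f assume f: "f \<in> dual_space V M"
  then obtain C where "\<forall>x\<in>V. \<bar>f x\<bar> \<le> C * M x"
    by (auto simp: dual_space_def bounded_functional_on_def)
  then have "\<forall>x\<in>V. \<bar>c * f x\<bar> \<le> (\<bar>c\<bar> * C) * M x"
    by (simp add: abs_mult mult.assoc mult_left_mono)
  with f show "(\<lambda>t. c * f t) \<in> dual_space V M"
    by (auto simp: dual_space_def bounded_functional_on_def distrib_left)
qed

section \<open>Dyadic intervals\<close>

lemma finite_dyadic [simp]: "finite (dyadic jk)"
  by (auto simp: dyadic_def split: prod.split)

lemma card_dyadic: "card (dyadic jk) = 2 ^ fst jk"
proof -
  obtain j k where jk: "jk = (j, k)" by (cases jk)
  have "2 ^ j * (k + 1) - 2 ^ j * k = (2 ^ j :: int)"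
    by (simp add: algebra_simps)
  then show ?thesis
    unfolding jk dyadic_def by (simp add: nat_power_eq)
qed

text \<open>
  Each integer lies in exactly one dyadic interval of each length. This turns sums over the
  intervals that contain a given integer into ordinary series over \<open>j\<close>.
\<close>

lemma mem_dyadic_iff: "n \<in> dyadic jk \<longleftrightarrow> jk = (fst jk, n div 2 ^ fst jk)"
proof -
  obtain j k where jk: "jk = (j, k)" by (cases jk)
  have "2 ^ j * k \<le> n \<and> n < 2 ^ j * (k + 1) \<longleftrightarrow> k = n div 2 ^ j"
  proof
    assume "2 ^ j * k \<le> n \<and> n < 2 ^ j * (k + 1)"
    then show "k = n div 2 ^ j"
      by (intro int_div_pos_eq[symmetric, where r = "n - 2 ^ j * k"]) (auto simp: algebra_simps)
  next
    assume k: "k = n div 2 ^ j"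
    have "n = 2 ^ j * (n div 2 ^ j) + n mod 2 ^ j" "0 \<le> n mod 2 ^ j" "n mod 2 ^ j < 2 ^ j"
      by auto
    then show "2 ^ j * k \<le> n \<and> n < 2 ^ j * (k + 1)"
      unfolding k by (simp only: algebra_simps) linarith
  qed
  then show ?thesis
    by (simp add: jk dyadic_def)
qed

lemma has_sum_dyadic_containing:
  fixes g :: "nat \<times> int \<Rightarrow> real"
  assumes "\<And>jk. n \<notin> dyadic jk \<Longrightarrow> g jk = 0" "summable (\<lambda>j. \<bar>g (j, n div 2 ^ j)\<bar>)"
  shows "(g has_sum (\<Sum>j. g (j, n div 2 ^ j))) UNIV"
proof -
  define h where "h = (\<lambda>j::nat. (j, n div 2 ^ j))"
  have "((\<lambda>j. g (h j)) has_sum (\<Sum>j. g (h j))) UNIV"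
    using assms(2) norm_summable_imp_has_sum[of "\<lambda>j. g (h j)"]
    by (simp add: h_def summable_rabs_cancel summable_sums)
  then have "(g has_sum (\<Sum>j. g (h j))) (range h)"
    by (subst has_sum_reindex) (auto simp: h_def inj_on_def o_def)
  moreover have "g jk = 0" if "jk \<notin> range h" for jk
    using that assms(1)[of jk] mem_dyadic_iff[of n jk] by (force simp: h_def)
  ultimately have "(g has_sum (\<Sum>j. g (h j))) UNIV"
    using has_sum_cong_neutral[of UNIV "range h" g g] by auto
  then show ?thesis
    by (simp add: h_def)
qed

section \<open>The space \<open>\<ell>\<^sup>p\<^sub>q\<^sub>,\<^sub>r\<close>\<close>

text \<open>
  The relations between the exponents give \<open>1 / p' - 1 / q' = 1 / q - 1 / p\<close>, which says that the size bound for a block is the weight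
  of the primal norm.
\<close>

locale lpqr_exponents =
  fixes p q r p' q' r' :: real
  assumes exponents: "1 < p" "p < q" "1 < r"
    and conj_p: "1 / p + 1 / p' = 1" and conj_q: "1 / q + 1 / q' = 1" and conj_r: "1 / r + 1 / r' = 1"
begin

lemma conj_gt1: "1 < p'" "1 < r'"
proof -
  have "p' = p / (p - 1)" "r' = r / (r - 1)"
    using exponents conj_p conj_r
    by (cases "p' = 0"; cases "r' = 0"; simp add: field_simps)+
  then show "1 < p'" "1 < r'"
    using exponents by auto
qed

lemmas gt1 = exponents(1,3) conj_gt1

lemma pos: "0 < p" "0 < r" "0 < p'" "0 < r'"
  using gt1 by auto

definition wt :: "nat \<times> int \<Rightarrow> real" where
  "wt jk = (2 ^ fst jk) powr (1 / q - 1 / p)"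

lemma wt_pos [simp]: "0 < wt jk"
  by (simp add: wt_def)

lemma wt_nonneg [simp]: "0 \<le> wt jk"
  by (simp add: less_imp_le)

lemma wt_nonzero [simp]: "wt jk \<noteq> 0"
  using wt_pos[of jk] by linarith

lemma weight_exponent_neg: "1 / q - 1 / p < 0"
  using exponents by (simp add: frac_less2)

lemma wt_le_1: "wt jk \<le> 1"
  using powr_mono[of "1 / q - 1 / p" 0 "2 ^ fst jk"] weight_exponent_neg by (simp add: wt_def)

lemma summable_wt: "summable (\<lambda>j. wt (j, k j))"
proof -
  define \<theta> :: real where "\<theta> = 2 powr (1 / q - 1 / p)"
  have "\<theta> < 1"
    using powr_less_mono[OF weight_exponent_neg, of 2] by (simp add: \<theta>_def)
  moreover have "wt (j, k j) = \<theta> ^ j" for j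
    by (simp add: wt_def \<theta>_def powr_powr mult.commute flip: powr_realpow)
  ultimately show ?thesis
    by (simp add: \<theta>_def)
qed

text \<open>
  The norm on \<open>\<ell>\<^sup>p\<^sub>q\<^sub>,\<^sub>r\<close> is the \<open>\<ell>\<^sup>r\<close> norm of these local quantities.
\<close>

definition scaled_norm :: "(int \<Rightarrow> real) \<Rightarrow> nat \<times> int \<Rightarrow> real" where
  "scaled_norm x jk = wt jk * lnorm p (dyadic jk) x"

abbreviation "X \<equiv> lpqr_space p q r"
abbreviation "N \<equiv> lpqr_norm p q r"

lemma scaled_norm_nonneg [simp]: "0 \<le> scaled_norm x jk"
  by (simp add: scaled_norm_def)

lemma lpqr_term_eq: "lpqr_term p q r x = (\<lambda>jk. \<bar>scaled_norm x jk\<bar> powr r)"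
proof
  fix jk :: "nat \<times> int"
  show "lpqr_term p q r x jk = \<bar>scaled_norm x jk\<bar> powr r"
    using pos by (cases jk)
      (simp add: lpqr_term_def scaled_norm_def wt_def lnorm_def powr_mult powr_powr mult.commute)
qed

lemma X_iff: "x \<in> X \<longleftrightarrow> scaled_norm x \<in> lp_space r"
  by (simp add: lpqr_space_def lp_space_def lpqr_term_eq)

lemma N_eq: "N x = lp_norm r (scaled_norm x)"
  by (simp add: lpqr_norm_def lp_norm_def lpqr_term_eq)

lemma N_nonneg [simp]: "0 \<le> N x"
  by (simp add: lpqr_norm_def)

lemma XI:
  assumes "\<And>S. finite S \<Longrightarrow> lnorm r S (scaled_norm x) \<le> C"
  shows "x \<in> X" "N x \<le> C"
  using lp_space_lnormI[OF pos(2) assms] by (simp_all add: X_iff N_eq)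

lemma lnorm_scaled_norm_le: "x \<in> X \<Longrightarrow> finite S \<Longrightarrow> lnorm r S (scaled_norm x) \<le> N x"
  unfolding X_iff N_eq by (intro lnorm_le_lp_norm pos)

lemma X_add:
  assumes "x \<in> X" "y \<in> X"
  shows "(\<lambda>n. x n + y n) \<in> X"
proof (rule XI)
  fix S :: "(nat \<times> int) set" assume S: "finite S"
  have tri: "scaled_norm (\<lambda>n. x n + y n) jk \<le> scaled_norm x jk + scaled_norm y jk" for jk
    unfolding scaled_norm_def distrib_left[symmetric]
    by (intro mult_left_mono Minkowski_lnorm gt1) auto
  have "lnorm r S (scaled_norm (\<lambda>n. x n + y n))
      \<le> lnorm r S (\<lambda>jk. scaled_norm x jk + scaled_norm y jk)"
    using tri by (intro lnorm_mono pos) (auto simp: abs_of_nonneg)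
  also have "\<dots> \<le> lnorm r S (scaled_norm x) + lnorm r S (scaled_norm y)"
    by (intro Minkowski_lnorm gt1 S)
  also have "\<dots> \<le> N x + N y"
    using assms S by (intro add_mono lnorm_scaled_norm_le)
  finally show "lnorm r S (scaled_norm (\<lambda>n. x n + y n)) \<le> N x + N y" .
qed

lemma scaled_norm_scale: "scaled_norm (\<lambda>n. c * x n) = (\<lambda>jk. \<bar>c\<bar> * scaled_norm x jk)"
  by (auto simp: scaled_norm_def lnorm_scale pos)

lemma X_scale:
  assumes "x \<in> X"
  shows "(\<lambda>n. c * x n) \<in> X" "N (\<lambda>n. c * x n) \<le> \<bar>c\<bar> * N x"
proof -
  have "lnorm r S (scaled_norm (\<lambda>n. c * x n)) \<le> \<bar>c\<bar> * N x" if "finite S" for S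
    unfolding scaled_norm_scale
    using lnorm_scaled_norm_le[OF assms that] by (simp add: lnorm_scale pos mult_left_mono)
  then show "(\<lambda>n. c * x n) \<in> X" "N (\<lambda>n. c * x n) \<le> \<bar>c\<bar> * N x"
    using XI by blast+
qed

lemma X_solid:
  assumes "x \<in> X" "\<And>n. \<bar>y n\<bar> \<le> \<bar>x n\<bar>"
  shows "y \<in> X"
proof (rule XI(1))
  fix S :: "(nat \<times> int) set" assume S: "finite S"
  have "lnorm r S (scaled_norm y) \<le> lnorm r S (scaled_norm x)"
    using assms(2)
    by (intro lnorm_mono pos) (auto simp: abs_of_nonneg scaled_norm_def intro!: mult_left_mono lnorm_mono pos)
  then show "lnorm r S (scaled_norm y) \<le> N x"
    using lnorm_scaled_norm_le[OF assms(1) S] by linarith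
qed

text \<open>
  Infinitely many intervals contain \<open>n\<close>, one at each level, so membership depends on
  the weights decaying geometrically, which is the effect of \<open>p < q\<close>.
\<close>

lemma unit_seq_in_X: "unit_seq n \<in> X"
proof -
  have sn: "scaled_norm (unit_seq n) jk = (if n \<in> dyadic jk then wt jk else 0)" for jk
  proof -
    have "(\<Sum>l\<in>dyadic jk. \<bar>unit_seq n l\<bar> powr p) = (\<Sum>l\<in>dyadic jk. if l = n then 1 else 0)"
      by (intro sum.cong) (auto simp: unit_seq_def)
    then show ?thesis
      by (simp add: scaled_norm_def lnorm_def)
  qed
  have "wt (j, k) powr r \<le> wt (j, k)" for j k
    using powr_mono'[of 1 r "wt (j, k)"] exponents wt_le_1 by simp
  then have "summable (\<lambda>j. wt (j, n div 2 ^ j) powr r)"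
    by (intro summable_comparison_test'[OF summable_wt[of "\<lambda>j. n div 2 ^ j"]]) auto
  then have "((\<lambda>jk. \<bar>scaled_norm (unit_seq n) jk\<bar> powr r) has_sum
      (\<Sum>j. \<bar>scaled_norm (unit_seq n) (j, n div 2 ^ j)\<bar> powr r)) UNIV"
    by (intro has_sum_dyadic_containing) (auto simp: sn mem_dyadic_iff)
  then show ?thesis
    by (auto simp: X_iff lp_space_def has_sum_iff)
qed

lemma finite_support_in_X:
  assumes "finite F" "\<And>n. n \<notin> F \<Longrightarrow> x n = 0"
  shows "x \<in> X"
proof -
  have zero: "(\<lambda>_. 0) \<in> X"
    using X_scale(1)[OF unit_seq_in_X, of 0 0] by simp
  have "(\<lambda>k. \<Sum>n\<in>G. x n * unit_seq n k) \<in> X" if "finite G" for G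
    using that zero by induction (auto intro!: X_add X_scale unit_seq_in_X)
  moreover have "(\<lambda>k. \<Sum>n\<in>F. x n * unit_seq n k) = x"
    using assms by (force simp: unit_seq_def if_distrib cong: if_cong)
  ultimately show ?thesis
    using assms(1) by metis
qed

section \<open>Families supported on the dyadic intervals\<close>

text \<open>
  The coefficient that a block expansion assigns to \<open>b jk\<close>: the smallest \<open>\<lambda> \<ge> 0\<close> for which \<open>b jk\<close> is
  \<open>\<lambda>\<close> times a block.
\<close>

definition rel_size :: "(nat \<times> int \<Rightarrow> int \<Rightarrow> real) \<Rightarrow> nat \<times> int \<Rightarrow> real" where
  "rel_size b jk = lnorm p' (dyadic jk) (b jk) / wt jk"

text \<open>
  The families that come from block expansions with coefficients of norm at most \<open>C\<close>. The bound is
  imposed on finite sets of intervals, so that it is a closed condition for pointwise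
  convergence.
\<close>

definition families :: "real \<Rightarrow> (nat \<times> int \<Rightarrow> int \<Rightarrow> real) set" where
  "families C = {b. (\<forall>jk n. n \<notin> dyadic jk \<longrightarrow> b jk n = 0) \<and>
     (\<forall>S. finite S \<longrightarrow> lnorm r' S (rel_size b) \<le> C)}"

text \<open>
  The sum over all \<open>jk\<close> at the integer \<open>n\<close>, written as a series over the levels \<open>j\<close>
  because at each level only the interval containing \<open>n\<close> contributes.
\<close>

definition family_sum :: "(nat \<times> int \<Rightarrow> int \<Rightarrow> real) \<Rightarrow> int \<Rightarrow> real" where
  "family_sum b n = (\<Sum>j. b (j, n div 2 ^ j) n)"

lemma rel_size_nonneg [simp]: "0 \<le> rel_size b jk"
  by (simp add: rel_size_def)

lemma families_support: "b \<in> families C \<Longrightarrow> n \<notin> dyadic jk \<Longrightarrow> b jk n = 0"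
  unfolding families_def by blast

lemma families_size: "b \<in> families C \<Longrightarrow> finite S \<Longrightarrow> lnorm r' S (rel_size b) \<le> C"
  unfolding families_def by blast

text \<open>
  This bound, summable along the intervals through a fixed \<open>n\<close>, makes \<open>family_sum\<close> converge
  uniformly on \<open>families C\<close>.
\<close>

lemma families_bound:
  assumes "b \<in> families C"
  shows "\<bar>b jk n\<bar> \<le> C * wt jk"
proof -
  have "\<bar>rel_size b jk\<bar> \<le> lnorm r' {jk} (rel_size b)"
    by (intro abs_le_lnorm pos) auto
  also have "\<dots> \<le> C"
    by (rule families_size[OF assms]) simp
  finally have size: "lnorm p' (dyadic jk) (b jk) \<le> C * wt jk"
    by (simp add: rel_size_def field_simps)
  show ?thesis
  proof (cases "n \<in> dyadic jk")
    case True
    have "\<bar>b jk n\<bar> \<le> lnorm p' (dyadic jk) (b jk)"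
      using True by (intro abs_le_lnorm pos) auto
    with size show ?thesis by linarith
  next
    case False
    then have "b jk n = 0"
      by (rule families_support[OF assms])
    moreover have "0 \<le> C * wt jk"
      using size lnorm_nonneg order_trans by blast
    ultimately show ?thesis by simp
  qed
qed

lemma zero_in_families: "0 \<le> C \<Longrightarrow> (\<lambda>_ _. 0) \<in> families C"
  by (simp add: families_def rel_size_def lnorm_def)

lemma families_convex:
  assumes "b \<in> families C" "c \<in> families C" "0 \<le> t" "t \<le> 1"
  shows "(\<lambda>jk n. (1 - t) * b jk n + t * c jk n) \<in> families C"
proof -
  define d where "d = (\<lambda>jk n. (1 - t) * b jk n + t * c jk n)"
  have size: "rel_size d jk \<le> (1 - t) * rel_size b jk + t * rel_size c jk" for jk
  proof -
    have "lnorm p' (dyadic jk) (d jk)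
        \<le> lnorm p' (dyadic jk) (\<lambda>n. (1 - t) * b jk n) + lnorm p' (dyadic jk) (\<lambda>n. t * c jk n)"
      unfolding d_def by (intro Minkowski_lnorm gt1) auto
    also have "\<dots> = (1 - t) * lnorm p' (dyadic jk) (b jk) + t * lnorm p' (dyadic jk) (c jk)"
      using assms by (simp add: lnorm_scale pos)
    finally show ?thesis
      unfolding rel_size_def by (simp add: divide_right_mono flip: add_divide_distrib)
  qed
  have "lnorm r' S (rel_size d) \<le> C" if S: "finite S" for S
  proof -
    have "lnorm r' S (rel_size d) \<le> lnorm r' S (\<lambda>jk. (1 - t) * rel_size b jk + t * rel_size c jk)"
      using size assms(3,4) by (intro lnorm_mono pos) (simp add: abs_of_nonneg)
    also have "\<dots> \<le> lnorm r' S (\<lambda>jk. (1 - t) * rel_size b jk) + lnorm r' S (\<lambda>jk. t * rel_size c jk)"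
      by (intro Minkowski_lnorm gt1 S)
    also have "\<dots> = (1 - t) * lnorm r' S (rel_size b) + t * lnorm r' S (rel_size c)"
      using assms by (simp add: lnorm_scale pos)
    also have "\<dots> \<le> (1 - t) * C + t * C"
      using assms S by (intro add_mono mult_left_mono) (auto simp: families_def)
    finally show ?thesis
      by (simp add: algebra_simps)
  qed
  then show ?thesis
    using assms unfolding families_def by (auto simp: d_def)
qed

lemma has_sum_family_sum:
  assumes "b \<in> families C"
  shows "((\<lambda>jk. b jk n) has_sum family_sum b n) UNIV"
  unfolding family_sum_def
proof (rule has_sum_dyadic_containing)
  show "summable (\<lambda>j. \<bar>b (j, n div 2 ^ j) n\<bar>)"
    using families_bound[OF assms]
    by (intro summable_comparison_test'[OF summable_mult[OF summable_wt[of "\<lambda>j. n div 2 ^ j"], of C]]) auto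
qed (use assms in \<open>auto simp: families_def\<close>)

lemma family_sum_convex:
  assumes "b \<in> families C" "c \<in> families C" "0 \<le> t" "t \<le> 1"
  shows "family_sum (\<lambda>jk n. (1 - t) * b jk n + t * c jk n) n = (1 - t) * family_sum b n + t * family_sum c n"
proof (rule has_sum_unique)
  show "((\<lambda>jk. (1 - t) * b jk n + t * c jk n) has_sum
      family_sum (\<lambda>jk n. (1 - t) * b jk n + t * c jk n) n) UNIV"
    by (rule has_sum_family_sum[OF families_convex[OF assms]])
  show "((\<lambda>jk. (1 - t) * b jk n + t * c jk n) has_sum (1 - t) * family_sum b n + t * family_sum c n) UNIV"
    using assms by (intro has_sum_add has_sum_cmult_right has_sum_family_sum)
qed

text \<open>
  A uniform limit of finite sums of coordinates, by the Weierstrass test. Convergence here is only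
  pointwise in \<open>b\<close>, so the uniform bound is essential.
\<close>

lemma continuous_on_family_sum: "continuous_on (families C) (\<lambda>b. family_sum b n)"
  unfolding family_sum_def
proof (rule uniform_limit_theorem)
  have "continuous_on UNIV (\<lambda>b::nat \<times> int \<Rightarrow> int \<Rightarrow> real. b jk n)" for jk
    by (rule continuous_on_product_then_coordinatewise[OF continuous_on_product_coordinates])
  then have "continuous_on (families C) (\<lambda>b. b jk n)" for jk
    using continuous_on_subset by blast
  then show "\<forall>\<^sub>F m in sequentially. continuous_on (families C) (\<lambda>b. \<Sum>j<m. b (j, n div 2 ^ j) n)"
    by (intro always_eventually allI continuous_on_sum) auto
  show "uniform_limit (families C) (\<lambda>m b. \<Sum>j<m. b (j, n div 2 ^ j) n)
      (\<lambda>b. \<Sum>j. b (j, n div 2 ^ j) n) sequentially"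
    by (rule Weierstrass_m_test[OF _ summable_mult[OF summable_wt[of "\<lambda>j. n div 2 ^ j"], of C]])
      (use families_bound in auto)
qed auto

lemma compact_families: "compact (families C)"
proof -
  have coord [continuous_intros]: "continuous_on UNIV (\<lambda>b::nat \<times> int \<Rightarrow> int \<Rightarrow> real. b jk n)" for jk n
    by (rule continuous_on_product_then_coordinatewise[OF continuous_on_product_coordinates])
  have size [continuous_intros]: "continuous_on UNIV (\<lambda>b. rel_size b jk)" for jk
    unfolding rel_size_def lnorm_def
    using pos by (intro continuous_intros continuous_on_powr') (auto intro: sum_nonneg)
  have "continuous_on UNIV (\<lambda>b. lnorm r' S (rel_size b))" for S
    unfolding lnorm_def
    using pos by (intro continuous_intros continuous_on_powr') (auto intro: sum_nonneg)
  then have "closed {b. lnorm r' S (rel_size b) \<le> C}" for S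
    by (intro closed_Collect_le continuous_intros)
  then have "closed (\<Inter>S\<in>Collect finite. {b. lnorm r' S (rel_size b) \<le> C})"
    by blast
  moreover have "closed (\<Inter>jk. \<Inter>n\<in>- dyadic jk. {b::nat \<times> int \<Rightarrow> int \<Rightarrow> real. b jk n = 0})"
    by (intro closed_INT ballI closed_Collect_eq continuous_intros)
  moreover have "families C = (\<Inter>jk. \<Inter>n\<in>- dyadic jk. {b. b jk n = 0}) \<inter>
      (\<Inter>S\<in>Collect finite. {b. lnorm r' S (rel_size b) \<le> C})"
    unfolding families_def by blast
  ultimately have "closed (families C)"
    by (simp add: closed_Int)
  moreover have "families C = {b. \<forall>jk n. \<bar>b jk n\<bar> \<le> C * wt jk} \<inter> families C"
    using families_bound by auto
  ultimately show ?thesis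
    using compact_Int_closed[OF compact_box[of "\<lambda>jk n. C * wt jk"], of "families C"] by simp
qed

section \<open>Functionals come from families\<close>

text \<open>
  Holder's inequality is sharp: the family is assembled from a norming vector \<open>\<mu>\<close> across the intervals
  in \<open>S\<close> and a norming vector \<open>z jk\<close> inside each of them. Taking \<open>S\<close> finite keeps every sum
  finite; the supremum over \<open>S\<close> recovers the norm of \<open>x\<close>.
\<close>

lemma norming_family:
  assumes "finite F" "\<And>n. n \<notin> F \<Longrightarrow> x n = 0" "finite S" "0 \<le> C"
  obtains b where "b \<in> families C" "(\<Sum>n\<in>F. x n * family_sum b n) = C * lnorm r S (scaled_norm x)"
proof -
  obtain \<mu> where \<mu>: "lnorm r' S \<mu> \<le> 1" "(\<Sum>jk\<in>S. scaled_norm x jk * \<mu> jk) = lnorm r S (scaled_norm x)"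
    using norming_exists[of r r' S "scaled_norm x"] gt1 conj_r by blast
  have "\<exists>z. lnorm p' (dyadic jk) z \<le> 1 \<and> (\<Sum>n\<in>dyadic jk. x n * z n) = lnorm p (dyadic jk) x" for jk
    using norming_exists[of p p' "dyadic jk" x] gt1 conj_p by blast
  then obtain z where z: "\<And>jk. lnorm p' (dyadic jk) (z jk) \<le> 1"
    "\<And>jk. (\<Sum>n\<in>dyadic jk. x n * z jk n) = lnorm p (dyadic jk) x"
    by metis
  define b where "b = (\<lambda>jk n. if jk \<in> S \<and> n \<in> dyadic jk then C * wt jk * \<mu> jk * z jk n else 0)"
  have size: "rel_size b jk \<le> C * \<bar>\<mu> jk\<bar>" if "jk \<in> S" for jk
  proof -
    have "lnorm p' (dyadic jk) (b jk) = lnorm p' (dyadic jk) (\<lambda>n. (C * wt jk * \<mu> jk) * z jk n)"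
      using that by (intro lnorm_cong) (simp add: b_def)
    also have "\<dots> = C * wt jk * \<bar>\<mu> jk\<bar> * lnorm p' (dyadic jk) (z jk)"
      using assms(4) by (simp add: lnorm_scale pos abs_mult)
    also have "\<dots> \<le> C * wt jk * \<bar>\<mu> jk\<bar>"
      using z(1) assms(4) by (intro mult_left_le) auto
    finally show ?thesis
      by (simp add: rel_size_def field_simps)
  qed
  have zero: "rel_size b jk = 0" if "jk \<notin> S" for jk
    using that by (simp add: rel_size_def b_def)
  have "lnorm r' S' (rel_size b) \<le> C" if "finite S'" for S'
  proof -
    have "lnorm r' S' (rel_size b) \<le> lnorm r' (S' \<union> S) (rel_size b)"
      using that assms by (intro lnorm_mono_set pos) auto
    also have "\<dots> = lnorm r' S (rel_size b)"
      unfolding lnorm_def using that assms zero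
      by (intro arg_cong[where f = "\<lambda>t. t powr (1 / r')"] sum.mono_neutral_right) auto
    also have "\<dots> \<le> lnorm r' S (\<lambda>jk. C * \<mu> jk)"
      using size assms(4) by (intro lnorm_mono pos) (simp add: abs_mult)
    also have "\<dots> \<le> C"
      using \<mu>(1) assms(4) by (simp add: lnorm_scale pos mult_left_le)
    finally show ?thesis .
  qed
  then have b: "b \<in> families C"
    by (auto simp: families_def b_def)
  have total: "family_sum b n = (\<Sum>jk\<in>S. b jk n)" for n
  proof (rule has_sum_unique[OF has_sum_family_sum[OF b]])
    show "((\<lambda>jk. b jk n) has_sum (\<Sum>jk\<in>S. b jk n)) UNIV"
      using assms by (intro has_sum_finite_neutralI) (auto simp: b_def)
  qed
  have "(\<Sum>n\<in>F. x n * family_sum b n) = (\<Sum>jk\<in>S. \<Sum>n\<in>F. x n * b jk n)"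
    unfolding total sum_distrib_left by (rule sum.swap)
  also have "\<dots> = (\<Sum>jk\<in>S. C * (scaled_norm x jk * \<mu> jk))"
  proof (rule sum.cong[OF refl])
    fix jk assume jk: "jk \<in> S"
    have "(\<Sum>n\<in>F. x n * b jk n) = (\<Sum>n\<in>F \<union> dyadic jk. x n * b jk n)"
      using assms by (intro sum.mono_neutral_left) auto
    also have "\<dots> = (\<Sum>n\<in>dyadic jk. x n * b jk n)"
      using assms by (intro sum.mono_neutral_right) (auto simp: b_def)
    also have "\<dots> = (\<Sum>n\<in>dyadic jk. C * wt jk * \<mu> jk * (x n * z jk n))"
      using jk by (intro sum.cong) (auto simp: b_def)
    also have "\<dots> = C * wt jk * \<mu> jk * lnorm p (dyadic jk) x"
      by (simp add: z(2) flip: sum_distrib_left)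
    finally show "(\<Sum>n\<in>F. x n * b jk n) = C * (scaled_norm x jk * \<mu> jk)"
      by (simp add: scaled_norm_def)
  qed
  also have "\<dots> = C * lnorm r S (scaled_norm x)"
    by (simp add: \<mu>(2) flip: sum_distrib_left)
  finally show ?thesis
    using that b by blast
qed

text \<open>
  This step takes the place of the Hahn--Banach theorem. The family \<open>b0\<close> gives the point nearest to
  \<open>y\<close> on \<open>F\<close>, and the error \<open>x\<close> is used as a test vector. Moving from \<open>b0\<close> towards any other
  family cannot decrease the error, so \<open>b0\<close> maximises the pairing with \<open>x\<close>; comparing this maximum
  with the assumed bound for \<open>y\<close> leaves no room for a nonzero \<open>x\<close>.
\<close>

lemma finite_representation:
  assumes C: "0 \<le> C" and F: "finite F"
    and y: "\<And>x. (\<And>n. n \<notin> F \<Longrightarrow> x n = 0) \<Longrightarrow> (\<Sum>n\<in>F. x n * y n) \<le> C * N x"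
  shows "\<exists>b\<in>families C. \<forall>n\<in>F. family_sum b n = y n"
proof -
  define G where "G = (\<lambda>b. \<Sum>n\<in>F. (family_sum b n - y n)\<^sup>2)"
  have "continuous_on (families C) G"
    unfolding G_def by (intro continuous_intros continuous_on_family_sum)
  then obtain b0 where b0: "b0 \<in> families C" "\<And>b. b \<in> families C \<Longrightarrow> G b0 \<le> G b"
    using continuous_attains_inf[OF compact_families] zero_in_families[OF C] by blast
  define x where "x = (\<lambda>n. if n \<in> F then y n - family_sum b0 n else 0)"
  have variation: "(\<Sum>n\<in>F. x n * family_sum b n) \<le> (\<Sum>n\<in>F. x n * family_sum b0 n)" if b: "b \<in> families C" for b
  proof -
    define D where "D = (\<Sum>n\<in>F. x n * (family_sum b0 n - family_sum b n))"
    define E where "E = (\<Sum>n\<in>F. (family_sum b n - family_sum b0 n)\<^sup>2)"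
    have "0 \<le> D"
    proof (rule linear_coefficient_nonneg[of D E])
      fix t :: real assume t: "0 < t" "t \<le> 1"
      define c where "c = (\<lambda>jk n. (1 - t) * b0 jk n + t * b jk n)"
      have "c \<in> families C"
        unfolding c_def using b0 b t by (intro families_convex) auto
      then have "G b0 \<le> G c"
        by (rule b0(2))
      also have "G c = (\<Sum>n\<in>F. (family_sum b0 n - y n)\<^sup>2 + (2 * t * (x n * (family_sum b0 n - family_sum b n)) + t\<^sup>2 * (family_sum b n - family_sum b0 n)\<^sup>2))"
        unfolding G_def
      proof (rule sum.cong[OF refl])
        fix n assume "n \<in> F"
        then have xn: "x n = y n - family_sum b0 n"
          by (simp add: x_def)
        have cn: "family_sum c n = (1 - t) * family_sum b0 n + t * family_sum b n"
          unfolding c_def using b0 b t by (intro family_sum_convex) auto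
        show "(family_sum c n - y n)\<^sup>2 = (family_sum b0 n - y n)\<^sup>2 +
            (2 * t * (x n * (family_sum b0 n - family_sum b n)) + t\<^sup>2 * (family_sum b n - family_sum b0 n)\<^sup>2)"
          unfolding cn xn by (simp add: power2_eq_square algebra_simps)
      qed
      also have "\<dots> = G b0 + (2 * t * D + t\<^sup>2 * E)"
        by (simp add: sum.distrib D_def E_def G_def sum_distrib_left)
      finally show "0 \<le> 2 * t * D + t\<^sup>2 * E"
        by simp
    qed
    then show ?thesis
      by (simp add: D_def right_diff_distrib sum_subtractf)
  qed
  have x0: "x n = 0" if "n \<notin> F" for n
    using that by (simp add: x_def)
  have *: "C * lnorm r S (scaled_norm x) \<le> (\<Sum>n\<in>F. x n * family_sum b0 n)" if S: "finite S" for S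
  proof -
    obtain b where "b \<in> families C" "(\<Sum>n\<in>F. x n * family_sum b n) = C * lnorm r S (scaled_norm x)"
      using norming_family[OF F x0 S C] .
    then show ?thesis
      using variation[of b] by simp
  qed
  have "0 \<le> (\<Sum>n\<in>F. x n * family_sum b0 n)"
    using *[of "{}"] by (simp add: lnorm_def)
  then have "C * N x \<le> (\<Sum>n\<in>F. x n * family_sum b0 n)"
  proof (cases "C = 0")
    case False
    with C have "0 < C" by simp
    then have "N x \<le> (\<Sum>n\<in>F. x n * family_sum b0 n) / C"
      using * by (intro XI(2)) (simp add: pos_le_divide_eq mult.commute)
    then show ?thesis
      using \<open>0 < C\<close> by (simp add: pos_le_divide_eq mult.commute)
  qed simp
  also have "\<dots> = (\<Sum>n\<in>F. x n * y n) - (\<Sum>n\<in>F. (x n)\<^sup>2)"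
  proof -
    have "x n * family_sum b0 n = x n * y n - (x n)\<^sup>2" for n
      by (simp add: x_def power2_eq_square algebra_simps)
    then show ?thesis
      by (simp add: sum_subtractf)
  qed
  also have "\<dots> \<le> C * N x - (\<Sum>n\<in>F. (x n)\<^sup>2)"
    using y[of x] x0 by auto
  finally have "(\<Sum>n\<in>F. (x n)\<^sup>2) \<le> 0"
    by simp
  then have "\<forall>n\<in>F. x n = 0"
    using F sum_nonneg_eq_0_iff[of F "\<lambda>n. (x n)\<^sup>2"] by (simp add: antisym sum_nonneg)
  then show ?thesis
    using b0(1) by (intro bexI[of _ b0]) (auto simp: x_def)
qed

text \<open>
  The families that match \<open>y\<close> at \<open>n\<close> form closed subsets of a compact set, and finitely many of
  these subsets always meet.
\<close>

lemma representation:
  assumes C: "0 \<le> C"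
    and y: "\<And>F x. finite F \<Longrightarrow> (\<And>n. n \<notin> F \<Longrightarrow> x n = 0) \<Longrightarrow> (\<Sum>n\<in>F. x n * y n) \<le> C * N x"
  obtains b where "b \<in> families C" "family_sum b = y"
proof -
  define A where "A = (\<lambda>n. {b \<in> families C. family_sum b n = y n})"
  have "families C \<inter> (\<Inter>n\<in>UNIV. A n) \<noteq> {}"
  proof (rule compact_imp_fip_image[OF compact_families])
    fix n
    show "closed (A n)"
      unfolding A_def using compact_families continuous_on_family_sum
      by (intro continuous_closed_preimage_constant compact_imp_closed)
  next
    fix F :: "int set" assume "finite F"
    then show "families C \<inter> (\<Inter>n\<in>F. A n) \<noteq> {}"
      using finite_representation[OF C _ y, of F] by (auto simp: A_def)
  qed
  then obtain b where "b \<in> families C" "\<forall>n. family_sum b n = y n"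
    by (auto simp: A_def)
  then show ?thesis
    using that by blast
qed

section \<open>Families define functionals\<close>

text \<open>
  The double series over the intervals and their elements converges absolutely with the stated bound,
  so it may be summed over the intervals first or over the integers first.
\<close>

lemma family_pairing:
  assumes x: "x \<in> X" and b: "b \<in> families C"
  obtains H where "((\<lambda>n. x n * family_sum b n) has_sum H) UNIV" "\<bar>H\<bar> \<le> C * N x"
proof -
  define h where "h = (\<lambda>(jk, n). x n * b jk n)"
  have "lnorm r' {} (rel_size b) \<le> C"
    by (rule families_size[OF b]) simp
  then have C: "0 \<le> C"
    by (simp add: lnorm_def)
  have dyadic_sums: "(\<Sum>jk\<in>S. \<Sum>n\<in>dyadic jk. \<bar>h (jk, n)\<bar>) \<le> C * N x" if S: "finite S" for S
  proof -
    have "(\<Sum>n\<in>dyadic jk. \<bar>h (jk, n)\<bar>) \<le> \<bar>scaled_norm x jk * rel_size b jk\<bar>" for jk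
    proof -
      have "(\<Sum>n\<in>dyadic jk. \<bar>x n * b jk n\<bar>) \<le> lnorm p (dyadic jk) x * lnorm p' (dyadic jk) (b jk)"
        using gt1 conj_p by (intro Holder_lnorm) auto
      then show ?thesis
        by (simp add: h_def scaled_norm_def rel_size_def)
    qed
    then have "(\<Sum>jk\<in>S. \<Sum>n\<in>dyadic jk. \<bar>h (jk, n)\<bar>) \<le> (\<Sum>jk\<in>S. \<bar>scaled_norm x jk * rel_size b jk\<bar>)"
      by (rule sum_mono)
    also have "\<dots> \<le> lnorm r S (scaled_norm x) * lnorm r' S (rel_size b)"
      using gt1 conj_r S by (intro Holder_lnorm) auto
    also have "\<dots> \<le> N x * C"
      using x b S by (intro mult_mono lnorm_scaled_norm_le families_size) auto
    finally show ?thesis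
      by (simp add: mult.commute)
  qed
  have finite_sums: "(\<Sum>z\<in>Q. norm (h z)) \<le> C * N x" if Q: "finite Q" for Q
  proof -
    have h0: "h z = 0" if "z \<notin> Sigma (fst ` Q) dyadic" "z \<in> Q" for z
      using that families_support[OF b, of "snd z" "fst z"] by (cases z) (force simp: h_def)
    \<comment> \<open>A finite set of pairs is enlarged to a union of full intervals; outside the intervals the terms vanish.\<close>
    have "(\<Sum>z\<in>Q. norm (h z)) = (\<Sum>z\<in>Q \<inter> Sigma (fst ` Q) dyadic. norm (h z))"
      using Q h0 by (intro sum.mono_neutral_right) auto
    also have "\<dots> \<le> (\<Sum>z\<in>Sigma (fst ` Q) dyadic. norm (h z))"
      using Q by (intro sum_mono2) auto
    also have "\<dots> = (\<Sum>jk\<in>fst ` Q. \<Sum>n\<in>dyadic jk. \<bar>h (jk, n)\<bar>)"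
      using Q by (subst sum.Sigma) (auto simp: case_prod_unfold)
    finally show ?thesis
      using dyadic_sums[of "fst ` Q"] Q by simp
  qed
  have abs: "(\<lambda>z. norm (h z)) summable_on UNIV"
    unfolding abs_summable_iff_bdd_above using finite_sums by (auto simp: bdd_above_def)
  define H where "H = infsum h UNIV"
  have "norm H \<le> (\<Sum>\<^sub>\<infinity>z. norm (h z))"
    unfolding H_def using abs by (rule norm_infsum_bound)
  also have "\<dots> \<le> C * N x"
    using abs finite_sums by (intro infsum_le_finite_sums) auto
  finally have bound: "\<bar>H\<bar> \<le> C * N x"
    by simp
  have "(h has_sum H) (UNIV \<times> UNIV)"
    using abs_summable_summable[OF abs] by (simp add: H_def)
  then have swapped: "((\<lambda>(n, jk). h (jk, n)) has_sum H) (UNIV \<times> UNIV)"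
    by (simp only: has_sum_swap[of h])
  have "((\<lambda>n. x n * family_sum b n) has_sum H) UNIV"
  proof (rule has_sum_SigmaD[OF swapped])
    fix n
    show "((\<lambda>jk. case (n, jk) of (n, jk) \<Rightarrow> h (jk, n)) has_sum x n * family_sum b n) UNIV"
      using has_sum_cmult_right[OF has_sum_family_sum[OF b, of n], of "x n"] by (simp add: h_def)
  qed
  then show ?thesis
    using bound that by blast
qed

section \<open>Bounded functionals\<close>

text \<open>
  Choose finitely many intervals that carry all but \<open>\<epsilon>\<close> to the power \<open>r\<close> of the norm to the power \<open>r\<close>. Once \<open>F\<close>
  contains their union, removing \<open>F\<close> annihilates these terms and increases none of the others.
\<close>

lemma truncation_tail_small:
  assumes x: "x \<in> X" and \<epsilon>: "0 < \<epsilon>"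
  shows "\<forall>\<^sub>F F in finite_subsets_at_top UNIV. N (\<lambda>n. if n \<in> F then 0 else x n) \<le> \<epsilon>"
proof -
  define e where "e = (\<lambda>jk. \<bar>scaled_norm x jk\<bar> powr r)"
  have e: "e summable_on UNIV"
    using x by (simp add: X_iff lp_space_def e_def)
  obtain S where S: "finite S" "dist (sum e S) (infsum e UNIV) \<le> \<epsilon> powr r"
    using infsum_finite_approximation[OF e, of "\<epsilon> powr r"] \<epsilon> by auto
  have rest: "sum e (S' - S) \<le> \<epsilon> powr r" if "finite S'" for S'
  proof -
    have "sum e (S \<union> (S' - S)) \<le> infsum e UNIV"
      using that S e by (intro finite_sum_le_infsum) (auto simp: e_def)
    moreover have "sum e (S \<union> (S' - S)) = sum e S + sum e (S' - S)"
      using that S by (intro sum.union_disjoint) auto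
    ultimately show ?thesis
      using S(2) by (simp add: dist_real_def)
  qed
  define F0 where "F0 = (\<Union>jk\<in>S. dyadic jk)"
  have "N (\<lambda>n. if n \<in> F then 0 else x n) \<le> \<epsilon>" if F: "F0 \<subseteq> F" for F
  proof (rule XI(2))
    fix S' :: "(nat \<times> int) set" assume S': "finite S'"
    define u where "u = (\<lambda>n. if n \<in> F then 0 else x n)"
    have vanish: "scaled_norm u jk = 0" if "jk \<in> S" for jk
    proof -
      have "lnorm p (dyadic jk) u = lnorm p (dyadic jk) (\<lambda>_. 0)"
        using F that by (intro lnorm_cong) (auto simp: u_def F0_def)
      then show ?thesis
        by (simp add: scaled_norm_def)
    qed
    have "scaled_norm u jk \<le> scaled_norm x jk" for jk
      unfolding scaled_norm_def by (intro mult_left_mono lnorm_mono pos) (auto simp: u_def)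
    then have le: "\<bar>scaled_norm u jk\<bar> powr r \<le> e jk" for jk
      unfolding e_def using pos by (intro powr_mono2) (auto simp: abs_of_nonneg)
    have "(\<Sum>jk\<in>S'. \<bar>scaled_norm u jk\<bar> powr r) = (\<Sum>jk\<in>S' - S. \<bar>scaled_norm u jk\<bar> powr r)"
      using S' vanish by (intro sum.mono_neutral_right) auto
    also have "\<dots> \<le> sum e (S' - S)"
      by (intro sum_mono le)
    also have "\<dots> \<le> \<epsilon> powr r"
      by (rule rest[OF S'])
    finally have "lnorm r S' (scaled_norm u) \<le> (\<epsilon> powr r) powr (1 / r)"
      unfolding lnorm_def using pos by (intro powr_mono2 sum_nonneg) auto
    then show "lnorm r S' (scaled_norm u) \<le> \<epsilon>"
      using pos \<epsilon> by (simp add: powr_powr)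
  qed
  then show ?thesis
    using S(1) by (auto simp: eventually_finite_subsets_at_top F0_def intro!: exI[of _ "\<Union>jk\<in>S. dyadic jk"])
qed

lemma functional_finite_support:
  assumes f: "bounded_functional_on X N f" and "finite F" "\<And>n. n \<notin> F \<Longrightarrow> x n = 0"
  shows "f x = (\<Sum>n\<in>F. x n * f (unit_seq n))"
proof -
  have add: "f (\<lambda>t. u t + v t) = f u + f v" if "u \<in> X" "v \<in> X" for u v
    using f that by (simp add: bounded_functional_on_def)
  have scale: "f (\<lambda>t. c * u t) = c * f u" if "u \<in> X" for c u
    using f that by (simp add: bounded_functional_on_def)
  define g where "g = (\<lambda>G k. \<Sum>n\<in>G. x n * unit_seq n k)"
  have gX: "g G \<in> X" if "finite G" for G
    unfolding g_def using that by (rule finite_support_in_X) (auto simp: unit_seq_def intro!: sum.neutral)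
  have gF: "g F = x"
    using assms(2,3) by (force simp: g_def unit_seq_def if_distrib cong: if_cong)
  have "f (g G) = (\<Sum>n\<in>G. x n * f (unit_seq n))" if "finite G" for G
    using that
  proof induction
    case empty
    show ?case
      using scale[OF unit_seq_in_X, of 0 0] by (simp add: g_def)
  next
    case (insert m G)
    have "g (insert m G) = (\<lambda>k. x m * unit_seq m k + g G k)"
      using insert by (simp add: g_def)
    then show ?case
      using insert gX by (simp add: add scale X_scale unit_seq_in_X)
  qed
  from this[OF assms(2)] show ?thesis
    using gF by simp
qed

text \<open>
  On finitely supported sequences this is linearity; the general case follows by density.
\<close>

lemma functional_has_sum:
  assumes f: "bounded_functional_on X N f" and x: "x \<in> X"
  shows "((\<lambda>n. x n * f (unit_seq n)) has_sum f x) UNIV"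
  unfolding has_sum_def tendsto_iff
proof (intro allI impI)
  fix e :: real assume e: "0 < e"
  obtain C where C: "\<And>u. u \<in> X \<Longrightarrow> \<bar>f u\<bar> \<le> C * N u"
    using f unfolding bounded_functional_on_def by blast
  \<comment> \<open>The summand 1 avoids a division by zero and makes the final estimate strict.\<close>
  define \<epsilon> where "\<epsilon> = e / (\<bar>C\<bar> + 1)"
  have \<epsilon>: "0 < \<epsilon>"
    using e by (simp add: \<epsilon>_def add_nonneg_pos)
  have fin: "\<forall>\<^sub>F F in finite_subsets_at_top (UNIV :: int set). finite F"
    by (rule eventually_finite_subsets_at_top_weakI)
  show "\<forall>\<^sub>F F in finite_subsets_at_top UNIV. dist (\<Sum>n\<in>F. x n * f (unit_seq n)) (f x) < e"
    using truncation_tail_small[OF x \<epsilon>] fin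
  proof eventually_elim
    case (elim F)
    define u where "u = (\<lambda>n. if n \<in> F then 0 else x n)"
    define v where "v = (\<lambda>n. if n \<in> F then x n else 0)"
    have u: "u \<in> X" and v: "v \<in> X"
      by (auto intro!: X_solid[OF x] simp: u_def v_def)
    have "x = (\<lambda>n. v n + u n)"
      by (auto simp: u_def v_def)
    then have "f x = f v + f u"
      using f u v by (simp add: bounded_functional_on_def)
    moreover have "f v = (\<Sum>n\<in>F. v n * f (unit_seq n))"
      by (rule functional_finite_support[OF f elim(2)]) (simp add: v_def)
    moreover have "(\<Sum>n\<in>F. v n * f (unit_seq n)) = (\<Sum>n\<in>F. x n * f (unit_seq n))"
      by (simp add: v_def)
    ultimately have "dist (\<Sum>n\<in>F. x n * f (unit_seq n)) (f x) = \<bar>f u\<bar>"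
      by (simp add: dist_real_def)
    also have "\<dots> \<le> C * N u"
      by (rule C[OF u])
    also have "\<dots> \<le> \<bar>C\<bar> * \<epsilon>"
      using elim(1) by (intro mult_mono) (auto simp: u_def)
    also have "\<dots> < (\<bar>C\<bar> + 1) * \<epsilon>"
      using \<epsilon> by simp
    also have "\<dots> = e"
      by (simp add: \<epsilon>_def add_nonneg_pos)
    finally show ?case .
  qed
qed

text \<open>
  If \<open>N x = 0\<close> then no rescaling to the unit ball is possible, and boundedness of \<open>f\<close> is used
  directly.
\<close>

lemma functional_le_dual_norm:
  assumes f: "bounded_functional_on X N f" and x: "x \<in> X"
  shows "\<bar>f x\<bar> \<le> dual_norm X N f * N x" "0 \<le> dual_norm X N f"
proof -
  obtain C where C: "\<And>u. u \<in> X \<Longrightarrow> \<bar>f u\<bar> \<le> C * N u"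
    using f unfolding bounded_functional_on_def by blast
  have scale: "f (\<lambda>t. c * u t) = c * f u" if "u \<in> X" for c u
    using f that by (simp add: bounded_functional_on_def)
  have "\<bar>f u\<bar> \<le> \<bar>C\<bar>" if "u \<in> X" "N u \<le> 1" for u
  proof -
    have "C * N u \<le> \<bar>C\<bar> * 1"
      using that by (intro mult_mono) auto
    with C[OF that(1)] show ?thesis by simp
  qed
  then have "bdd_above {\<bar>f u\<bar> | u. u \<in> X \<and> N u \<le> 1}"
    by (auto simp: bdd_above_def)
  then have ball: "\<bar>f u\<bar> \<le> dual_norm X N f" if "u \<in> X" "N u \<le> 1" for u
    unfolding dual_norm_def using that by (intro cSup_upper) auto
  have "(\<lambda>n. 0 * x n) \<in> X" "N (\<lambda>n. 0 * x n) \<le> 1"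
    using X_scale[OF x, of 0] by auto
  from ball[OF this] show "0 \<le> dual_norm X N f"
    by linarith
  show "\<bar>f x\<bar> \<le> dual_norm X N f * N x"
  proof (cases "N x = 0")
    case True
    then show ?thesis using C[OF x] by simp
  next
    case False
    then have Nx: "0 < N x"
      by (simp add: less_le)
    define u where "u = (\<lambda>n. (1 / N x) * x n)"
    have "u \<in> X" "N u \<le> 1"
      using X_scale[OF x, of "1 / N x"] Nx by (auto simp: u_def)
    then have "\<bar>f u\<bar> \<le> dual_norm X N f"
      by (rule ball)
    moreover have "f u = (1 / N x) * f x"
      unfolding u_def by (rule scale[OF x])
    ultimately show ?thesis
      using Nx by (simp add: abs_mult field_simps)
  qed
qed

lemma dual_norm_le:
  assumes "\<And>x. x \<in> X \<Longrightarrow> \<bar>f x\<bar> \<le> C * N x" "0 \<le> C"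
  shows "dual_norm X N f \<le> C"
  unfolding dual_norm_def
proof (rule cSup_least)
  have "(\<lambda>n. 0 * unit_seq 0 n) \<in> X" "N (\<lambda>n. 0 * unit_seq 0 n) \<le> 1"
    using X_scale[OF unit_seq_in_X, of 0 0] by auto
  then show "{\<bar>f x\<bar> | x. x \<in> X \<and> N x \<le> 1} \<noteq> {}"
    by blast
  fix t assume "t \<in> {\<bar>f x\<bar> | x. x \<in> X \<and> N x \<le> 1}"
  then obtain x where x: "t = \<bar>f x\<bar>" "x \<in> X" "N x \<le> 1"
    by blast
  have "C * N x \<le> C * 1"
    using x assms(2) by (intro mult_left_mono) auto
  with assms(1)[OF x(2)] x(1) show "t \<le> C"
    by simp
qed

section \<open>Families and block representations\<close>

lemma block_bound_eq_wt: "real (card (dyadic jk)) powr (1 / p' - 1 / q') = wt jk"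
proof -
  have "1 / p' - 1 / q' = 1 / q - 1 / p"
    using conj_p conj_q by linarith
  then show ?thesis
    by (simp add: card_dyadic wt_def)
qed

lemma block_rep_family:
  assumes "block_rep p' q' r' y c a"
  shows "(\<lambda>jk n. c jk * a jk n) \<in> families (lp_norm r' c)"
    and "family_sum (\<lambda>jk n. c jk * a jk n) = y"
proof -
  define b where "b = (\<lambda>jk n. c jk * a jk n)"
  have c: "c \<in> lp_space r'" and block: "\<And>jk. is_block q' p' (dyadic jk) (a jk)"
    and sum: "has_sum_l1_loc b y"
    using assms by (auto simp: block_rep_def b_def)
  have supp: "a jk n = 0" if "n \<notin> dyadic jk" for jk n
    using block[of jk] that by (auto simp: is_block_def)
  have "rel_size b jk \<le> \<bar>c jk\<bar>" for jk
  proof -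
    have "lp_norm p' (a jk) = lnorm p' (dyadic jk) (a jk)"
      using supp by (intro lp_norm_finite_support) auto
    then have "lnorm p' (dyadic jk) (a jk) \<le> wt jk"
      using block[of jk] by (simp add: is_block_def block_bound_eq_wt)
    then have "\<bar>c jk\<bar> * lnorm p' (dyadic jk) (a jk) \<le> \<bar>c jk\<bar> * wt jk"
      by (intro mult_left_mono) auto
    then show ?thesis
      by (simp add: rel_size_def b_def lnorm_scale pos pos_divide_le_eq)
  qed
  then have "lnorm r' S (rel_size b) \<le> lp_norm r' c" if "finite S" for S
    using lnorm_mono[of r' S "rel_size b" c] lnorm_le_lp_norm[OF pos(4) c that] pos
    by (force simp: abs_of_nonneg)
  then have b: "b \<in> families (lp_norm r' c)"
    using supp by (auto simp: families_def b_def)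
  then show "(\<lambda>jk n. c jk * a jk n) \<in> families (lp_norm r' c)"
    by (simp add: b_def)
  have "family_sum b n = y n" for n
  proof (rule has_sum_unique[OF has_sum_family_sum[OF b]])
    have "((\<lambda>S. \<bar>(\<Sum>jk\<in>S. b jk n) - y n\<bar>) \<longlongrightarrow> 0) (finite_subsets_at_top UNIV)"
      using sum[unfolded has_sum_l1_loc_def, rule_format, of "{n}"] by simp
    then show "((\<lambda>jk. b jk n) has_sum y n) UNIV"
      unfolding has_sum_def by (simp add: tendsto_rabs_zero_iff LIM_zero_iff)
  qed
  then show "family_sum (\<lambda>jk n. c jk * a jk n) = y"
    by (auto simp: b_def)
qed

text \<open>
  The coefficient of a block is the relative size of \<open>b jk\<close>. Where it is 0, the sequence \<open>b jk\<close>
  vanishes and the quotient defining the block is 0 as well.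
\<close>

lemma family_block_rep:
  assumes b: "b \<in> families C"
  obtains c a where "block_rep p' q' r' (family_sum b) c a" "lp_norm r' c \<le> C"
proof -
  define c where "c = rel_size b"
  define a where "a = (\<lambda>jk n. (1 / c jk) * b jk n)"
  have c: "c \<in> lp_space r'" "lp_norm r' c \<le> C"
    using lp_space_lnormI[OF pos(4) families_size[OF b]] by (auto simp: c_def)
  have "b jk n = 0" if "c jk = 0" for jk n
    using that families_support[OF b, of n jk] lnorm_pos_imp_nonzero[OF pos(3) finite_dyadic, of jk "b jk" n]
    by (cases "n \<in> dyadic jk") (auto simp: c_def rel_size_def)
  then have ca: "c jk * a jk n = b jk n" for jk n
    by (cases "c jk = 0") (auto simp: a_def)
  have "is_block q' p' (dyadic jk) (a jk)" for jk
  proof -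
    have supp: "a jk n = 0" if "n \<notin> dyadic jk" for n
      using families_support[OF b that] by (simp add: a_def)
    have "lnorm p' (dyadic jk) (a jk) = \<bar>1 / c jk\<bar> * lnorm p' (dyadic jk) (b jk)"
      unfolding a_def by (rule lnorm_scale[OF pos(3)])
    also have "\<dots> \<le> wt jk"
      by (simp add: c_def rel_size_def)
    finally show ?thesis
      using supp lp_norm_finite_support[OF finite_dyadic, of jk "a jk" p']
      by (auto simp: is_block_def block_bound_eq_wt)
  qed
  moreover have "has_sum_l1_loc b (family_sum b)"
    unfolding has_sum_l1_loc_def
  proof (intro allI impI tendsto_null_sum)
    fix F :: "int set" and n
    show "((\<lambda>S. \<bar>(\<Sum>jk\<in>S. b jk n) - family_sum b n\<bar>) \<longlongrightarrow> 0) (finite_subsets_at_top UNIV)"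
      using has_sum_family_sum[OF b, of n] unfolding has_sum_def
      by (simp add: tendsto_rabs_zero_iff LIM_zero_iff)
  qed
  ultimately have "block_rep p' q' r' (family_sum b) c a"
    using c by (simp add: block_rep_def ca)
  then show ?thesis
    using that c by blast
qed

abbreviation "H \<equiv> block_space p' q' r'"

lemma family_in_block_space:
  assumes "b \<in> families C"
  shows "family_sum b \<in> H" "block_norm p' q' r' (family_sum b) \<le> C"
proof -
  obtain c a where ca: "block_rep p' q' r' (family_sum b) c a" "lp_norm r' c \<le> C"
    using family_block_rep[OF assms] .
  then show "family_sum b \<in> H"
    by (auto simp: block_space_def)
  have "block_norm p' q' r' (family_sum b) \<le> lp_norm r' c"
    unfolding block_norm_def
    using ca by (intro cInf_lower) (auto intro!: bdd_belowI[of _ 0])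
  with ca show "block_norm p' q' r' (family_sum b) \<le> C"
    by linarith
qed

section \<open>The duality\<close>

text \<open>
  Applying \<open>representation\<close> with the dual norm itself as the constant gives the sharp bound.
\<close>

lemma functional_coefficients:
  assumes f: "bounded_functional_on X N f"
  shows "(\<lambda>n. f (unit_seq n)) \<in> H"
    and "block_norm p' q' r' (\<lambda>n. f (unit_seq n)) \<le> dual_norm X N f"
proof -
  have "\<exists>b\<in>families (dual_norm X N f). family_sum b = (\<lambda>n. f (unit_seq n))"
  proof (rule representation[of "dual_norm X N f" "\<lambda>n. f (unit_seq n)"])
    show "0 \<le> dual_norm X N f"
      by (rule functional_le_dual_norm(2)[OF f unit_seq_in_X])
  next
    fix F and x :: "int \<Rightarrow> real" assume Fx: "finite F" "\<And>n. n \<notin> F \<Longrightarrow> x n = 0"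
    have "(\<Sum>n\<in>F. x n * f (unit_seq n)) = f x"
      using functional_finite_support[OF f Fx] by simp
    also have "\<dots> \<le> dual_norm X N f * N x"
      using functional_le_dual_norm(1)[OF f finite_support_in_X[of F x]] Fx by fastforce
    finally show "(\<Sum>n\<in>F. x n * f (unit_seq n)) \<le> dual_norm X N f * N x" .
  qed blast
  then obtain b where b: "b \<in> families (dual_norm X N f)" "family_sum b = (\<lambda>n. f (unit_seq n))"
    by blast
  show "(\<lambda>n. f (unit_seq n)) \<in> H"
    "block_norm p' q' r' (\<lambda>n. f (unit_seq n)) \<le> dual_norm X N f"
    using family_in_block_space[OF b(1)] unfolding b(2) by this+
qed

lemma block_pairing:
  assumes "block_rep p' q' r' y c a" "x \<in> X"
  shows "(\<lambda>n. x n * y n) summable_on UNIV" "\<bar>pairing x y\<bar> \<le> lp_norm r' c * N x"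
proof -
  obtain s where "((\<lambda>n. x n * y n) has_sum s) UNIV" "\<bar>s\<bar> \<le> lp_norm r' c * N x"
    using family_pairing[OF assms(2) block_rep_family(1)[OF assms(1)]]
    unfolding block_rep_family(2)[OF assms(1)] .
  then show "(\<lambda>n. x n * y n) summable_on UNIV" "\<bar>pairing x y\<bar> \<le> lp_norm r' c * N x"
    by (auto simp: has_sum_iff pairing_def)
qed

lemma block_pairing_summable:
  "y \<in> H \<Longrightarrow> x \<in> X \<Longrightarrow> (\<lambda>n. x n * y n) summable_on UNIV"
  using block_pairing(1) by (auto simp: block_space_def)

text \<open>
  The value 0 off the space selects the representative that the dual space contains.
\<close>

definition functional_of :: "(int \<Rightarrow> real) \<Rightarrow> (int \<Rightarrow> real) \<Rightarrow> real" where
  "functional_of y x = (if x \<in> X then pairing x y else 0)"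

lemma functional_of_unit_seq [simp]: "functional_of y (unit_seq n) = y n"
proof -
  have "((\<lambda>k. unit_seq n k * y k) has_sum (\<Sum>k\<in>{n}. unit_seq n k * y k)) UNIV"
    by (rule has_sum_finite_neutralI[of "{n}"]) (auto simp: unit_seq_def)
  then have "pairing (unit_seq n) y = (\<Sum>k\<in>{n}. unit_seq n k * y k)"
    unfolding pairing_def by (rule infsumI)
  then show ?thesis
    using unit_seq_in_X[of n] by (simp add: functional_of_def) (simp add: unit_seq_def)
qed

lemma bounded_pairing:
  assumes "y \<in> H"
  shows "bounded_functional_on X N (\<lambda>x. pairing x y)"
  unfolding bounded_functional_on_def
proof (intro conjI ballI allI)
  fix u v assume "u \<in> X" "v \<in> X"
  then show "pairing (\<lambda>t. u t + v t) y = pairing u y + pairing v y"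
    using assms by (simp add: pairing_def distrib_right infsum_add block_pairing_summable)
next
  fix c u
  show "pairing (\<lambda>t. c * u t) y = c * pairing u y"
    by (simp add: pairing_def mult.assoc infsum_cmult_right')
next
  obtain c a where "block_rep p' q' r' y c a"
    using assms by (auto simp: block_space_def)
  then show "\<exists>C. \<forall>x\<in>X. \<bar>pairing x y\<bar> \<le> C * N x"
    using block_pairing(2) by blast
qed

lemma functional_of_in_dual:
  assumes "y \<in> H"
  shows "functional_of y \<in> dual_space X N"
proof -
  have "bounded_functional_on X N (functional_of y)"
    using bounded_pairing[OF assms] X_add X_scale(1)
    unfolding bounded_functional_on_def functional_of_def by simp
  then show ?thesis
    by (simp add: dual_space_def functional_of_def)
qed

lemma functional_of_coefficients:
  assumes "f \<in> dual_space X N"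
  shows "functional_of (\<lambda>n. f (unit_seq n)) = f"
proof
  fix x
  show "functional_of (\<lambda>n. f (unit_seq n)) x = f x"
    using functional_has_sum[of f x] assms
    by (auto simp: functional_of_def dual_space_def pairing_def has_sum_iff)
qed

lemma dual_norm_functional_of:
  assumes y: "y \<in> H"
  shows "dual_norm X N (functional_of y) = block_norm p' q' r' y"
proof (rule antisym)
  show "dual_norm X N (functional_of y) \<le> block_norm p' q' r' y"
    unfolding block_norm_def
  proof (rule cInf_greatest)
    show "{lp_norm r' c | c. \<exists>a. block_rep p' q' r' y c a} \<noteq> {}"
      using y by (auto simp: block_space_def)
    fix t assume "t \<in> {lp_norm r' c | c. \<exists>a. block_rep p' q' r' y c a}"
    then obtain c a where "t = lp_norm r' c" "block_rep p' q' r' y c a"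
      by blast
    then show "dual_norm X N (functional_of y) \<le> t"
      using block_pairing(2) by (intro dual_norm_le) (auto simp: functional_of_def)
  qed
  show "block_norm p' q' r' y \<le> dual_norm X N (functional_of y)"
    using functional_coefficients(2)[of "functional_of y"] functional_of_in_dual[OF y]
    by (simp add: dual_space_def)
qed

text \<open>
  Instead of recombining blocks interval by interval, a linear combination of elements is recognised
  as the coefficient sequence of the same combination of functionals, and the dual is a vector space.
\<close>

lemma lin_subspace_block_space: "lin_subspace H"
proof -
  have coeff: "(\<lambda>n. f (unit_seq n)) \<in> H" if "f \<in> dual_space X N" for f
    using functional_coefficients(1) that by (simp add: dual_space_def)
  note dual = lin_subspace_dual_space[of X N, unfolded lin_subspace_def]
  show ?thesis
    unfolding lin_subspace_def
  proof (intro conjI ballI allI)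
    show "(\<lambda>_. 0) \<in> H"
      using coeff dual by blast
  next
    fix y z assume "y \<in> H" "z \<in> H"
    then have "(\<lambda>x. functional_of y x + functional_of z x) \<in> dual_space X N"
      using dual functional_of_in_dual by blast
    from coeff[OF this] show "(\<lambda>t. y t + z t) \<in> H"
      by simp
  next
    fix c y assume "y \<in> H"
    then have "(\<lambda>x. c * functional_of y x) \<in> dual_space X N"
      using dual functional_of_in_dual by blast
    from coeff[OF this] show "(\<lambda>t. c * y t) \<in> H"
      by simp
  qed
qed

lemma isometric_isomorphism_functional_of:
  "isometric_isomorphism H (block_norm p' q' r') (dual_space X N) (dual_norm X N) functional_of"
  unfolding isometric_isomorphism_def
proof (intro conjI ballI allI lin_subspace_block_space lin_subspace_dual_space)
  show "bij_betw functional_of H (dual_space X N)"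
    by (rule bij_betw_byWitness[where f' = "\<lambda>f n. f (unit_seq n)"])
      (auto simp: functional_of_coefficients functional_of_in_dual functional_coefficients(1)
        dual_space_bounded)
next
  fix y z assume "y \<in> H" "z \<in> H"
  then show "functional_of (\<lambda>t. y t + z t) = (\<lambda>x. functional_of y x + functional_of z x)"
    by (auto simp: functional_of_def pairing_def distrib_left infsum_add block_pairing_summable)
next
  fix c y
  show "functional_of (\<lambda>t. c * y t) = (\<lambda>x. c * functional_of y x)"
    by (auto simp: functional_of_def pairing_def mult.left_commute infsum_cmult_right')
qed (rule dual_norm_functional_of)

end

theorem theorem6p7:
  fixes p q r p' q' r' :: real
  assumes "1 < p" and "p < q" and "1 < r"
    and "1 / p + 1 / p' = 1" and "1 / q + 1 / q' = 1" and "1 / r + 1 / r' = 1"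
  shows "isometric_isomorphism
           (block_space p' q' r') (block_norm p' q' r')
           (dual_space (lpqr_space p q r) (lpqr_norm p q r))
           (dual_norm (lpqr_space p q r) (lpqr_norm p q r))
           (\<lambda>y x. if x \<in> lpqr_space p q r then pairing x y else 0)
       \<and> (\<forall>f. bounded_functional_on (lpqr_space p q r) (lpqr_norm p q r) f \<longrightarrow>
           (\<lambda>n. f (unit_seq n)) \<in> block_space p' q' r' \<and>
           (\<forall>x\<in>lpqr_space p q r. ((\<lambda>n. x n * f (unit_seq n)) has_sum f x) UNIV))
       \<and> (\<forall>y\<in>block_space p' q' r'.
           (\<forall>x\<in>lpqr_space p q r. (\<lambda>n. x n * y n) summable_on UNIV) \<and>
           bounded_functional_on (lpqr_space p q r) (lpqr_norm p q r) (\<lambda>x. pairing x y))"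
proof -
  interpret lpqr_exponents p q r p' q' r'
    using assms by unfold_locales
  have "functional_of = (\<lambda>y x. if x \<in> X then pairing x y else 0)"
    by (intro ext) (rule functional_of_def)
  then show ?thesis
    using isometric_isomorphism_functional_of functional_coefficients(1) functional_has_sum
      block_pairing_summable bounded_pairing by simp
qed

end
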